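(* Let $k\geq 2$ be an integer. 1. Denote by $f_k(n)$ the number of words over $k$ of length $n$ that avoid the pattern $z,z+1,z$. Then, for $n\geq 3$, the numbers $f_k(n)$ satisfy the recursion \[f_k(n)=kf_k(n-1)-f_k(n-2)+f_k(n-3),\] with initial values $f_k(0)=1$, $f_k(1)=k$, and $f_k(2)=k^2$. In particular, the corresponding generating function $\sum_{n\geq 0}f_k(n)x^n$ is given by \[\frac{1+x^2}{1-kx+x^2-x^3}.\] 2. Denote by $g_k(n)$ the number of words over $k$ of length $n$ that avoid the pattern $z,z,z+1$. Then, for $n\geq 2k-1$, the numbers $g_k(n)$ satisfy the recursion \[g_k(n)=\sum_{i=0}^{k-1}(-1)^i(k-i)\,g_k(n-2i-1).\] Furthermore, the corresponding generating function $\sum_{n\geq 0}g_k(n)x^n$ is given by \[\frac{1}{1-\sum_{i=0}^{k-1}(-1)^i(k-i)x^{2i+1}}.\]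
   Context: For an integer $k\geq 2$ let $[k]=\{1,2,\ldots,k\}$. For a nonnegative integer $n$, a word over $k$ of length $n$ is an element of $[k]^n$ (there is exactly one word of length $0$). A word $w_1\cdots w_n\in[k]^n$ avoids the pattern $z,z+1,z$ if there are no $1\leq i\leq n-2$ and $z\in[k]$ such that $w_i=z$, $w_{i+1}=z+1$ and $w_{i+2}=z$. It avoids the pattern $z,z,z+1$ if there are no $1\leq i\leq n-2$ and $z\in[k]$ such that $w_i=z$, $w_{i+1}=z$ and $w_{i+2}=z+1$. *)

theory Defs
  imports "HOL-Computational_Algebra.Formal_Power_Series"
begin

definition words :: "nat \<Rightarrow> nat \<Rightarrow> nat list set" where
  "words k n = {w. length w = n \<and> set w \<subseteq> {1..k}}"

(* List positions are counted from 0. *)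

definition avoids_z_Sz_z :: "nat \<Rightarrow> nat list \<Rightarrow> bool" where
  "avoids_z_Sz_z k w \<longleftrightarrow>
     \<not> (\<exists>i z. i + 2 < length w \<and> z \<in> {1..k} \<and>
          w ! i = z \<and> w ! (i + 1) = z + 1 \<and> w ! (i + 2) = z)"

definition avoids_z_z_Sz :: "nat \<Rightarrow> nat list \<Rightarrow> bool" where
  "avoids_z_z_Sz k w \<longleftrightarrow>
     \<not> (\<exists>i z. i + 2 < length w \<and> z \<in> {1..k} \<and>
          w ! i = z \<and> w ! (i + 1) = z \<and> w ! (i + 2) = z + 1)"

definition f_count :: "nat \<Rightarrow> nat \<Rightarrow> nat" where
  "f_count k n = card {w \<in> words k n. avoids_z_Sz_z k w}"

definition g_count :: "nat \<Rightarrow> nat \<Rightarrow> nat" where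
  "g_count k n = card {w \<in> words k n. avoids_z_z_Sz k w}"

end

theory Submission
  imports Defs
begin

text \<open>Both patterns have the form \<open>z, s z, t z\<close> with \<open>t z \<noteq> s (s z)\<close>. Let \<open>A\<close> be the generating function
  of the avoiding words and \<open>H z\<close> that of those with first letter \<open>z\<close>. Putting \<open>z\<close> in front of an
  avoiding word fails only if that word starts with \<open>s z, t z\<close>; since \<open>t z \<noteq> s (s z)\<close>, these words are
  exactly the avoiding words with first letter \<open>t z\<close> preceded by \<open>s z\<close>. Hence
  \<open>H z = X A - X\<^sup>2 H (t z)\<close>, where the last term is absent if \<open>s z\<close> is not a letter. Together with
  \<open>A = 1 + (\<Sum>z. H z)\<close> this linear system determines \<open>A\<close>.\<close>

text \<open>The pair \<open>Suc\<close>, \<open>id\<close> encodes z, z+1, z and the pair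
  \<open>id\<close>, \<open>Suc\<close> encodes z, z, z+1. Reading the letter off as
  \<open>w ! i\<close> keeps the predicate free of \<open>k\<close>.\<close>

definition avoids_triples :: "(nat \<Rightarrow> nat) \<Rightarrow> (nat \<Rightarrow> nat) \<Rightarrow> nat list \<Rightarrow> bool" where
  "avoids_triples s t w \<longleftrightarrow>
     \<not> (\<exists>i. i + 2 < length w \<and> w ! (i + 1) = s (w ! i) \<and> w ! (i + 2) = t (w ! i))"

definition avoiders :: "(nat \<Rightarrow> nat) \<Rightarrow> (nat \<Rightarrow> nat) \<Rightarrow> nat \<Rightarrow> nat \<Rightarrow> nat list set" where
  "avoiders s t k n = {w \<in> words k n. avoids_triples s t w}"

definition headed_avoiders :: "(nat \<Rightarrow> nat) \<Rightarrow> (nat \<Rightarrow> nat) \<Rightarrow> nat \<Rightarrow> nat \<Rightarrow> nat \<Rightarrow> nat list set" where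
  "headed_avoiders s t k z n = {w \<in> avoiders s t k n. \<exists>u. w = z # u}"

section \<open>Both counts as instances of one generic count\<close>

lemma f_count_eq: "f_count k n = card (avoiders Suc id k n)"
proof -
  have "avoids_z_Sz_z k w \<longleftrightarrow> avoids_triples Suc id w" if "w \<in> words k n" for w
  proof -
    \<comment> \<open>Letters of \<open>w\<close> lie in the alphabet, so \<open>w ! i\<close>
      satisfies the range condition on \<open>z\<close>.\<close>
    have "w ! i \<in> {1..k}" if "i + 2 < length w" for i
      using \<open>w \<in> words k n\<close> that by (auto simp: words_def subset_iff)
    then show ?thesis
      unfolding avoids_z_Sz_z_def avoids_triples_def by auto
  qed
  then show ?thesis
    unfolding f_count_def avoiders_def by (intro arg_cong[of _ _ card]) blast
qed

lemma g_count_eq: "g_count k n = card (avoiders id Suc k n)"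
proof -
  have "avoids_z_z_Sz k w \<longleftrightarrow> avoids_triples id Suc w" if "w \<in> words k n" for w
  proof -
    have "w ! i \<in> {1..k}" if "i + 2 < length w" for i
      using \<open>w \<in> words k n\<close> that by (auto simp: words_def subset_iff)
    then show ?thesis
      unfolding avoids_z_z_Sz_def avoids_triples_def by auto
  qed
  then show ?thesis
    unfolding g_count_def avoiders_def by (intro arg_cong[of _ _ card]) blast
qed

section \<open>Avoiders classified by first letter\<close>

lemma avoids_triples_Nil: "avoids_triples s t []"
  by (simp add: avoids_triples_def)

lemma avoids_triples_Cons:
  "avoids_triples s t (a # w) \<longleftrightarrow> avoids_triples s t w \<and> \<not> (\<exists>u. w = s a # t a # u)"
proof -
  have "(\<exists>i. i + 2 < length (a # w) \<and> (a # w) ! (i + 1) = s ((a # w) ! i)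
          \<and> (a # w) ! (i + 2) = t ((a # w) ! i)) \<longleftrightarrow>
        (1 < length w \<and> w ! 0 = s a \<and> w ! 1 = t a) \<or>
        (\<exists>i. i + 2 < length w \<and> w ! (i + 1) = s (w ! i) \<and> w ! (i + 2) = t (w ! i))"
    (is "(\<exists>i. ?P i) \<longleftrightarrow> ?R \<or> (\<exists>i. ?Q i)")
  proof -
    have "(\<exists>i. ?P i) \<longleftrightarrow> ?P 0 \<or> (\<exists>i. ?P (Suc i))"
      by (metis not0_implies_Suc)
    then show ?thesis by simp
  qed
  moreover have "(1 < length w \<and> w ! 0 = s a \<and> w ! 1 = t a) \<longleftrightarrow> (\<exists>u. w = s a # t a # u)"
    \<comment> \<open>The rule serves only as a case split: empty, one letter, at least two
      letters.\<close>
    by (cases w rule: remdups_adj.cases) auto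
  ultimately show ?thesis
    unfolding avoids_triples_def by blast
qed

lemma finite_words: "finite (words k n)"
  unfolding words_def using finite_lists_length_eq[of "{1..k}" n] by (simp add: conj_commute)

lemma finite_avoiders: "finite (avoiders s t k n)"
  by (simp add: avoiders_def finite_words)

lemma finite_headed_avoiders: "finite (headed_avoiders s t k z n)"
  by (simp add: headed_avoiders_def finite_avoiders)

lemma avoiders_0: "avoiders s t k 0 = {[]}"
  by (auto simp: avoiders_def words_def avoids_triples_Nil)

lemma headed_avoiders_0: "headed_avoiders s t k z 0 = {}"
  by (auto simp: headed_avoiders_def avoiders_0)

lemma headed_avoiders_empty:
  assumes "z \<notin> {1..k}"
  shows "headed_avoiders s t k z n = {}"
  using assms by (auto simp: headed_avoiders_def avoiders_def words_def)

lemma card_avoiders_Suc: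
  "card (avoiders s t k (Suc n)) = (\<Sum>z=1..k. card (headed_avoiders s t k z (Suc n)))"
proof -
  have "avoiders s t k (Suc n) = (\<Union>z\<in>{1..k}. headed_avoiders s t k z (Suc n))"
    by (auto simp: headed_avoiders_def avoiders_def words_def length_Suc_conv)
  moreover have "headed_avoiders s t k y m \<inter> headed_avoiders s t k z m = {}" if "y \<noteq> z" for y z m
    using that by (auto simp: headed_avoiders_def)
  ultimately show ?thesis
    by (simp add: card_UN_disjoint finite_headed_avoiders)
qed

lemma headed_avoiders_Suc:
  assumes "z \<in> {1..k}"
  shows "headed_avoiders s t k z (Suc n) =
    (#) z ` (avoiders s t k n - {w. \<exists>u. w = s z # t z # u})"
  using assms by (auto simp: headed_avoiders_def avoiders_def words_def avoids_triples_Cons)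

lemma card_headed_avoiders_Suc:
  assumes "z \<in> {1..k}"
  shows "card (headed_avoiders s t k z (Suc n)) =
    card (avoiders s t k n - {w. \<exists>u. w = s z # t z # u})"
  unfolding headed_avoiders_Suc[OF assms] by (rule card_image) simp

lemma card_headed_avoiders_1:
  assumes "z \<in> {1..k}"
  shows "card (headed_avoiders s t k z (Suc 0)) = 1"
  unfolding card_headed_avoiders_Suc[OF assms] avoiders_0
  by (simp add: insert_Diff_if)

text \<open>The second summand counts the avoiders starting with \<open>s z\<close>,
  \<open>t z\<close>. Deleting their first letter is a bijection onto the avoiders headed by
  \<open>t z\<close>: putting \<open>s z\<close> back could only create an occurrence if
  \<open>t z = s (s z)\<close>, which \<open>st\<close> excludes. The sum form avoids subtraction on
  \<open>nat\<close>.\<close>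

lemma card_headed_avoiders_recursion:
  assumes z: "z \<in> {1..k}" and st: "t z \<noteq> s (s z)"
  shows "card (headed_avoiders s t k z (Suc (Suc n)))
      + (if s z \<in> {1..k} then card (headed_avoiders s t k (t z) n) else 0)
    = card (avoiders s t k (Suc n))"
proof -
  let ?B = "avoiders s t k (Suc n) \<inter> {w. \<exists>u. w = s z # t z # u}"
  have "card ?B = (if s z \<in> {1..k} then card (headed_avoiders s t k (t z) n) else 0)"
  proof (cases "s z \<in> {1..k}")
    case True
    then have "?B = (#) (s z) ` headed_avoiders s t k (t z) n"
      using st by (auto simp: headed_avoiders_def avoiders_def words_def avoids_triples_Cons)
    then show ?thesis
      using True by (simp add: card_image)
  next
    case False
    then have "?B = {}"
      by (auto simp: avoiders_def words_def)
    with False show ?thesis by (simp only: card.empty if_False)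
  qed
  moreover have "card (avoiders s t k (Suc n)) =
      card (avoiders s t k (Suc n) - {w. \<exists>u. w = s z # t z # u}) + card ?B"
    using card_Int_Diff[OF finite_avoiders] by (simp add: add.commute)
  ultimately show ?thesis
    using card_headed_avoiders_Suc[OF z, of s t "Suc n"] by simp
qed

section \<open>The linear system for the generating functions\<close>

definition avoiders_fps :: "(nat \<Rightarrow> nat) \<Rightarrow> (nat \<Rightarrow> nat) \<Rightarrow> nat \<Rightarrow> 'a::comm_ring_1 fps" where
  "avoiders_fps s t k = Abs_fps (\<lambda>n. of_nat (card (avoiders s t k n)))"

definition headed_fps :: "(nat \<Rightarrow> nat) \<Rightarrow> (nat \<Rightarrow> nat) \<Rightarrow> nat \<Rightarrow> nat \<Rightarrow> 'a::comm_ring_1 fps" where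
  "headed_fps s t k z = Abs_fps (\<lambda>n. of_nat (card (headed_avoiders s t k z n)))"

lemma headed_fps_eq_0:
  assumes "z \<notin> {1..k}"
  shows "headed_fps s t k z = 0"
  by (rule fps_ext) (simp add: headed_fps_def headed_avoiders_empty[OF assms])

lemma avoiders_fps_eq: "avoiders_fps s t k = 1 + (\<Sum>z=1..k. headed_fps s t k z)"
proof (rule fps_ext)
  fix n
  show "fps_nth (avoiders_fps s t k :: 'a fps) n =
      fps_nth (1 + (\<Sum>z=1..k. headed_fps s t k z)) n"
    by (cases n)
      (simp_all add: avoiders_fps_def headed_fps_def fps_sum_nth avoiders_0 headed_avoiders_0
        card_avoiders_Suc)
qed

lemma headed_fps_eq:
  assumes z: "z \<in> {1..k}" and st: "t z \<noteq> s (s z)"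
  shows "(headed_fps s t k z :: 'a::comm_ring_1 fps) = fps_X * avoiders_fps s t k
    - (if s z \<in> {1..k} then fps_X ^ 2 * headed_fps s t k (t z) else 0)"
proof (rule fps_ext)
  fix n
  \<comment> \<open>The recursion drops the length by two, so lengths 0 and 1 are compared
    directly.\<close>
  consider "n = 0" | "n = Suc 0" | m where "n = Suc (Suc m)"
    by (metis not0_implies_Suc)
  then show "fps_nth (headed_fps s t k z :: 'a fps) n = fps_nth (fps_X * avoiders_fps s t k
      - (if s z \<in> {1..k} then fps_X ^ 2 * headed_fps s t k (t z) else 0)) n"
  proof cases
    case 1
    then show ?thesis
      by (simp add: headed_fps_def headed_avoiders_0 fps_X_power_mult_nth)
  next
    case 2
    then show ?thesis
      using card_headed_avoiders_1[OF z, of s t]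
      by (simp add: headed_fps_def avoiders_fps_def avoiders_0 fps_X_power_mult_nth)
  next
    case 3
    then show ?thesis
      using arg_cong[OF card_headed_avoiders_recursion[of z k t s m, OF z st], of "of_nat :: nat \<Rightarrow> 'a"]
      by (auto simp: headed_fps_def avoiders_fps_def fps_X_power_mult_nth eq_diff_eq
          split: if_splits)
  qed
qed

section \<open>Solving the system for each pattern\<close>

lemma f_fps_equation:
  fixes A :: "'a::comm_ring_1 fps"
  assumes "k \<ge> 1"
  defines "A \<equiv> Abs_fps (\<lambda>n. of_nat (f_count k n))"
  shows "A * (1 - of_nat k * fps_X + fps_X ^ 2 - fps_X ^ 3) = 1 + fps_X ^ 2"
proof -
  let ?H = "headed_fps Suc id k :: nat \<Rightarrow> 'a fps"
  have A: "A = avoiders_fps Suc id k"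
    by (simp add: A_def avoiders_fps_def f_count_eq)
  \<comment> \<open>The letter \<open>k\<close> is split off: it has no successor in the alphabet,
    so its equation lacks the correction term.\<close>
  have k: "{1..k} = insert k {1..<k}"
    using assms(1) by auto
  have last: "?H k = fps_X * A"
    using headed_fps_eq[of k k id Suc] assms(1) by (simp add: A)
  have step: "?H z = fps_X * A - fps_X ^ 2 * ?H z" if "z \<in> {1..<k}" for z
    using headed_fps_eq[of z k id Suc] that by (simp add: A)
  \<comment> \<open>As \<open>t\<close> is \<open>id\<close>, each equation below \<open>k\<close>
    involves only its own \<open>?H z\<close>. Summing them relates \<open>S\<close> to
    \<open>A\<close> without dividing by \<open>1 + fps_X ^ 2\<close>; then \<open>S\<close> is
    eliminated.\<close>
  define S where "S = (\<Sum>z=1..<k. ?H z)"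
  have "S = (\<Sum>z=1..<k. fps_X * A - fps_X ^ 2 * ?H z)"
    unfolding S_def using step by (intro sum.cong) auto
  also have "\<dots> = of_nat (k - 1) * (fps_X * A) - fps_X ^ 2 * S"
    by (simp add: sum_subtractf sum_distrib_left S_def)
  finally have S: "S = (of_nat k - 1) * (fps_X * A) - fps_X ^ 2 * S"
    using assms(1) by (simp add: of_nat_diff)
  have "A = 1 + fps_X * A + S"
    using avoiders_fps_eq[of Suc id k, where 'a='a] unfolding A[symmetric] k
    by (simp add: last S_def algebra_simps)
  then have S': "S = A - 1 - fps_X * A"
    by (simp add: algebra_simps)
  show ?thesis
    using S unfolding S' by (simp add: algebra_simps power2_eq_square power3_eq_cube)
qed

text \<open>Each \<open>?H z\<close> depends on the series of the next letter, and that of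
  \<open>k + 1\<close> is zero. So the system is triangular and is solved from the letter
  \<open>k\<close> downwards.\<close>

lemma g_fps_equation:
  fixes A :: "'a::comm_ring_1 fps"
  assumes "k \<ge> 1"
  defines "A \<equiv> Abs_fps (\<lambda>n. of_nat (g_count k n))"
  shows "A = 1 + A * (\<Sum>i=0..k-1. (-1) ^ i * (of_nat k - of_nat i) * fps_X ^ (2 * i + 1))"
proof -
  let ?H = "headed_fps id Suc k :: nat \<Rightarrow> 'a fps"
  let ?S = "\<lambda>m. \<Sum>i<m. (-1) ^ i * (of_nat m - of_nat i) * fps_X ^ (2 * i + 1) :: 'a fps"
  have A: "A = avoiders_fps id Suc k"
    by (simp add: A_def avoiders_fps_def g_count_eq)
  have step: "?H (k - j) = fps_X * A - fps_X ^ 2 * ?H (Suc (k - j))" if "j < k" for j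
    using headed_fps_eq[of "k - j" k Suc id] that by (simp add: A Suc_le_eq)
  \<comment> \<open>The induction runs over the \<open>m\<close> largest letters;
    \<open>?S m\<close> is the target polynomial with \<open>m\<close> in place of
    \<open>k\<close>.\<close>
  have sum_H: "(\<Sum>j<m. ?H (k - j)) = A * ?S m" if "m \<le> k" for m
    using that
  proof (induction m)
    case 0
    then show ?case by simp
  next
    case (Suc m)
    \<comment> \<open>Raising the top \<open>m + 1\<close> letters by one turns \<open>k\<close>
      into a non-letter, which contributes zero, and leaves the top \<open>m\<close>
      letters.\<close>
    have shift: "(\<Sum>j<Suc m. ?H (Suc (k - j))) = (\<Sum>j<m. ?H (k - j))"
    proof -
      have "?H (Suc k) = 0"
        by (simp add: headed_fps_eq_0)
      moreover have "Suc (k - Suc j) = k - j" if "j < m" for j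
        using that Suc.prems by simp
      ultimately show ?thesis
        unfolding sum.lessThan_Suc_shift by simp
    qed
    have "(\<Sum>j<Suc m. ?H (k - j)) = (\<Sum>j<Suc m. fps_X * A - fps_X ^ 2 * ?H (Suc (k - j)))"
      using Suc.prems step by (intro sum.cong) auto
    also have "\<dots> = of_nat (Suc m) * (fps_X * A) - fps_X ^ 2 * (\<Sum>j<Suc m. ?H (Suc (k - j)))"
      by (simp only: sum_subtractf sum_distrib_left sum_constant card_lessThan)
    also have "\<dots> = A * (of_nat (Suc m) * fps_X - fps_X ^ 2 * ?S m)"
      using Suc by (simp only: shift) (simp add: algebra_simps)
    \<comment> \<open>The first term is the summand \<open>i = 0\<close>; multiplying by
      \<open>- fps_X ^ 2\<close> moves summand \<open>i\<close> of \<open>?S m\<close> to summand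
      \<open>i + 1\<close>, as \<open>m - i = (m + 1) - (i + 1)\<close>.\<close>
    also have "of_nat (Suc m) * fps_X - fps_X ^ 2 * ?S m = ?S (Suc m)"
      unfolding sum.lessThan_Suc_shift
      by (simp add: sum_distrib_left power2_eq_square sum_negf mult_ac)
    finally show ?case .
  qed
  have "(\<Sum>z=1..k. ?H z) = (\<Sum>j<k. ?H (k - j))"
    by (rule sum.reindex_bij_witness[of _ "\<lambda>j. k - j" "\<lambda>z. k - z"]) auto
  moreover have "{..<k} = {0..k-1}"
    using assms(1) by auto
  ultimately show ?thesis
    using avoiders_fps_eq[of id Suc k, where 'a='a] sum_H[of k] by (simp add: A)
qed

section \<open>From the equations to recursions and quotients\<close>

lemma fps_eq_one_divideI:
  fixes F G :: "'a::field fps"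
  assumes "F = 1 + F * G"
  shows "F = 1 / (1 - G)"
proof -
  have *: "F * (1 - G) = 1"
    using assms by (simp add: right_diff_distrib diff_eq_eq)
  then have "1 - G \<noteq> 0"
    by auto
  then show ?thesis
    using * by (metis nonzero_mult_div_cancel_right)
qed


theorem theorem9:
  fixes k :: nat
  assumes "k \<ge> 2"
  shows
    "((\<forall>n\<ge>3. int (f_count k n) = int k * int (f_count k (n - 1)) - int (f_count k (n - 2)) + int (f_count k (n - 3)))
      \<and> f_count k 0 = 1 \<and> f_count k 1 = k \<and> f_count k 2 = k ^ 2
      \<and> Abs_fps (\<lambda>n. of_nat (f_count k n) :: rat) =
          (1 + fps_X ^ 2) / (1 - of_nat k * fps_X + fps_X ^ 2 - fps_X ^ 3))
     \<and>
     ((\<forall>n\<ge>2 * k - 1. int (g_count k n) =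
          (\<Sum>i=0..k-1. (-1) ^ i * (int k - int i) * int (g_count k (n - 2 * i - 1))))
      \<and> Abs_fps (\<lambda>n. of_nat (g_count k n) :: rat) =
          1 / (1 - (\<Sum>i=0..k-1. (-1) ^ i * (of_nat k - of_nat i) * fps_X ^ (2 * i + 1))))"
proof -
  have k: "k \<ge> 1"
    using assms by simp
  have f_rec: "int (f_count k n) =
      int k * int (f_count k (n - 1)) - int (f_count k (n - 2)) + int (f_count k (n - 3))"
    if "n \<ge> 3" for n
  proof -
    \<comment> \<open>Coefficients are compared over \<open>int\<close>. For
      \<open>n \<ge> 3\<close> the right side \<open>1 + fps_X ^ 2\<close> contributes
      nothing.\<close>
    let ?A = "Abs_fps (\<lambda>n. of_nat (f_count k n)) :: int fps"
    have "fps_nth (?A - fps_const (int k) * (fps_X * ?A) + fps_X ^ 2 * ?A - fps_X ^ 3 * ?A) n =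
        fps_nth (1 + fps_X ^ 2) n"
      using f_fps_equation[OF k, where 'a=int]
      by (intro arg_cong[where f="\<lambda>F. fps_nth F n"]) (simp add: algebra_simps fps_of_nat)
    then show ?thesis
      using that by (simp add: fps_X_power_mult_nth fps_X_power_nth fps_mult_left_const_nth)
  qed
  have f_0: "f_count k 0 = 1"
    by (simp add: f_count_eq avoiders_0)
  have f_1: "f_count k 1 = k"
    using card_avoiders_Suc[of Suc id k 0] card_headed_avoiders_1[of _ k Suc id]
    by (simp add: f_count_eq)
  have f_2: "f_count k 2 = k ^ 2"
  proof -
    have "{w \<in> words k 2. avoids_z_Sz_z k w} = {w. set w \<subseteq> {1..k} \<and> length w = 2}"
      by (auto simp: words_def avoids_z_Sz_z_def)
    then show ?thesis
      by (simp add: f_count_def card_lists_length_eq)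
  qed
  have f_gf: "Abs_fps (\<lambda>n. of_nat (f_count k n) :: rat) =
      (1 + fps_X ^ 2) / (1 - of_nat k * fps_X + fps_X ^ 2 - fps_X ^ 3)" (is "?F = _ / ?D")
  proof -
    \<comment> \<open>Constant term 1 makes the denominator nonzero, so it cancels in the
      quotient.\<close>
    have "fps_nth ?D 0 = 1"
      by (simp add: fps_power_zeroth)
    then have "?D \<noteq> 0"
      by (intro notI) (simp only: fps_zero_nth zero_neq_one)
    then show ?thesis
      by (simp flip: f_fps_equation[OF k])
  qed
  have g_rec: "int (g_count k n) =
      (\<Sum>i=0..k-1. (-1) ^ i * (int k - int i) * int (g_count k (n - 2 * i - 1)))"
    if "n \<ge> 2 * k - 1" for n
  proof -
    let ?A = "Abs_fps (\<lambda>n. of_nat (g_count k n)) :: int fps"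
    let ?c = "\<lambda>i. (-1) ^ i * (int k - int i)"
    have c: "(-1) ^ i * (of_nat k - of_nat i) = fps_const (?c i)" for i
      by (simp add: fps_of_nat flip: fps_const_mult fps_const_sub fps_const_power fps_const_neg)
    have "fps_nth ?A n = fps_nth (1 + (\<Sum>i=0..k-1. fps_const (?c i) * (fps_X ^ (2 * i + 1) * ?A))) n"
      by (subst g_fps_equation[OF k]) (simp only: c sum_distrib_left mult_ac)
    also have "\<dots> = (\<Sum>i=0..k-1. ?c i * fps_nth (fps_X ^ (2 * i + 1) * ?A) n)"
      \<comment> \<open>Here \<open>n > 0\<close>, so the constant 1 drops out.\<close>
      using that assms by (simp only: fps_add_nth fps_sum_nth fps_mult_left_const_nth) simp
    also have "\<dots> = (\<Sum>i=0..k-1. ?c i * int (g_count k (n - 2 * i - 1)))"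
      \<comment> \<open>Since \<open>2 * i + 1 \<le> 2 * k - 1 \<le> n\<close>, no index is
        truncated.\<close>
      using that k by (intro sum.cong refl) (auto simp only: fps_X_power_mult_nth, auto)
    finally show ?thesis by simp
  qed
  have g_gf: "Abs_fps (\<lambda>n. of_nat (g_count k n) :: rat) =
      1 / (1 - (\<Sum>i=0..k-1. (-1) ^ i * (of_nat k - of_nat i) * fps_X ^ (2 * i + 1)))"
    by (rule fps_eq_one_divideI) (rule g_fps_equation[OF k])
  show ?thesis
    using f_rec f_0 f_1 f_2 f_gf g_rec g_gf by blast
qed

end
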